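(* Let $Q$ be the quiver on vertices $\{1,2,3,4,5\}$ with arrows $1\to2$, $1\to5$, $3\to1$, $4\to1$, $4\to5$, $5\to2$, $5\to3$, two arrows $2\to3$ and two arrows $3\to4$, with initial seed $(Q,(x_1,\dots,x_5))$, $x_1,\dots,x_5$ indeterminates. Define $x_n$ for all $n\in\mathbb{Z}$ by $x_n=(x_{n-1}x_{n-4}+x_{n-2}x_{n-3})/x_{n-5}$ for $n\ge6$ and $x_n=(x_{n+1}x_{n+4}+x_{n+2}x_{n+3})/x_{n+5}$ for $n\le0$; let $A=\frac{x_1x_5+x_3^2}{x_2x_4}$, $B=\frac{x_2x_6+x_4^2}{x_3x_5}$. Define $g(s,k)=\lfloor s/2\rfloor\lfloor (s+1)/2\rfloor$ if $k$ is even and $g(s,k)=\lfloor (s-1)/2\rfloor\lfloor s/2\rfloor$ if $k$ is odd, and set $\rho_1^{k}:=\rho_2^{-k}$ for $k<0$. Then for all $k\in\mathbb{Z}$ and $s\in\mathbb{Z}_{\ge0}$, the ordered cluster obtained by applying $\rho_1^{k}(\rho_3\rho_1)^s$ to the initial seed is $$\big(A^{g(s+1,k)}B^{g(s+1,k+1)}x_{k+s+1},\ A^{g(s,k)}B^{g(s,k+1)}x_{k+s+2},\ A^{g(s+1,k)}B^{g(s+1,k+1)}x_{k+s+3},$$ $$A^{g(s,k)}B^{g(s,k+1)}x_{k+s+4},\ A^{g(s+1,k)}B^{g(s+1,k+1)}x_{k+s+5}\big).$$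
   Context: A seed is a pair (quiver on $\{1,\dots,5\}$ without loops or 2-cycles, ordered cluster $(y_1,\dots,y_5)$). Mutation $\mu_i$: for each 2-path $j\to i\to k$ add an arrow $j\to k$; reverse arrows at $i$; delete 2-cycles; replace $y_i$ by $\big(\prod_{i\to j}y_j^{a_{i\to j}}+\prod_{j\to i}y_j^{a_{j\to i}}\big)/y_i$ ($a_{i\to j}$ = number of arrows $i\to j$ before mutation). For a permutation $\sigma$ in cycle notation, applying $\sigma$ relabels vertex $i$ as $\sigma(i)$ (variable at $i$ moves to $\sigma(i)$); e.g. $(54321)$ sends $1\mapsto5$ and $i\mapsto i-1$ for $i\ge2$. Operations compose left to right (leftmost first): $\rho_1=\mu_1\circ(54321)$, $\rho_2=\mu_5\circ(12345)$, $\rho_3=\mu_2\circ\mu_4\circ(24)$. In a product $\rho_a\rho_b$, $\rho_a$ is applied first; powers are repeated products and $\rho^0$ is the identity. *)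

theory Defs
  imports
    "HOL-Computational_Algebra.Fraction_Field"
    "HOL-Computational_Algebra.Polynomial"
    "HOL-Combinatorics.Cycles"
begin

text \<open>A quiver is given by its arrow multiplicities: \<open>a i j\<close> is the number of arrows
  from \<open>i\<close> to \<open>j\<close>.\<close>

type_synonym quiver = "nat \<Rightarrow> nat \<Rightarrow> nat"
type_synonym 'a seed = "quiver \<times> (nat \<Rightarrow> 'a)"

definition vertices :: "nat set" where
  "vertices = {1..5}"

definition is_quiver :: "quiver \<Rightarrow> bool" where
  "is_quiver a \<longleftrightarrow>
     (\<forall>i j. a i j > 0 \<longrightarrow> i \<in> vertices \<and> j \<in> vertices) \<and>
     (\<forall>i. a i i = 0) \<and>
     (\<forall>i j. a i j = 0 \<or> a j i = 0)"

definition add_paths :: "nat \<Rightarrow> quiver \<Rightarrow> quiver" where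
  "add_paths i a = (\<lambda>j k. a j k + a j i * a i k)"

definition reverse_at :: "nat \<Rightarrow> quiver \<Rightarrow> quiver" where
  "reverse_at i a = (\<lambda>j k. if j = i \<or> k = i then a k j else a j k)"

text \<open>Truncated subtraction: opposite arrows between \<open>j\<close> and \<open>k\<close> cancel in pairs.\<close>

definition delete_2cycles :: "quiver \<Rightarrow> quiver" where
  "delete_2cycles a = (\<lambda>j k. a j k - a k j)"

definition mutate_quiver :: "nat \<Rightarrow> quiver \<Rightarrow> quiver" where
  "mutate_quiver i a = delete_2cycles (reverse_at i (add_paths i a))"

definition mutate :: "nat \<Rightarrow> 'a::field seed \<Rightarrow> 'a seed" where
  "mutate i S = (case S of (a, y) \<Rightarrow>
     (mutate_quiver i a,
      y(i := ((\<Prod>j\<in>vertices. y j ^ a i j) + (\<Prod>j\<in>vertices. y j ^ a j i)) / y i)))"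

text \<open>The data at vertex \<open>i\<close> moves to vertex \<open>\<sigma> i\<close>.\<close>

definition relabel :: "(nat \<Rightarrow> nat) \<Rightarrow> 'a seed \<Rightarrow> 'a seed" where
  "relabel \<sigma> S = (case S of (a, y) \<Rightarrow>
     (\<lambda>i j. a (inv \<sigma> i) (inv \<sigma> j), \<lambda>i. y (inv \<sigma> i)))"

text \<open>Products of operations are read left to right, i.e. opposite to \<open>\<circ>\<close>.\<close>

definition rho1 :: "'a::field seed \<Rightarrow> 'a seed" where
  "rho1 = relabel (cycle_of_list [5, 4, 3, 2, 1]) \<circ> mutate 1"

definition rho2 :: "'a::field seed \<Rightarrow> 'a seed" where
  "rho2 = relabel (cycle_of_list [1, 2, 3, 4, 5]) \<circ> mutate 5"

definition rho3 :: "'a::field seed \<Rightarrow> 'a seed" where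
  "rho3 = relabel (cycle_of_list [2, 4]) \<circ> mutate 4 \<circ> mutate 2"

definition rho1_pow :: "int \<Rightarrow> 'a::field seed \<Rightarrow> 'a seed" where
  "rho1_pow k = (if k \<ge> 0 then rho1 ^^ nat k else rho2 ^^ nat (- k))"

definition ordered_cluster :: "'a seed \<Rightarrow> 'a list" where
  "ordered_cluster S = map (snd S) [1, 2, 3, 4, 5]"

definition Q :: quiver where
  "Q i j = count_list
     [(1, 2), (1, 5), (3, 1), (4, 1), (4, 5), (5, 2), (5, 3),
      (2, 3), (2, 3), (3, 4), (3, 4)] (i, j)"

text \<open>The field of rational functions over the rationals in five indeterminates, as the fraction
  field of the iterated polynomial ring; the innermost variable is the first one.\<close>

type_synonym ratfun = "rat poly poly poly poly poly fract"

definition indet :: "int \<Rightarrow> ratfun" where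
  "indet n =
     (if n = 1 then Fraction_Field.Fract [:[:[:[:[:0, 1:]:]:]:]:] 1
      else if n = 2 then Fraction_Field.Fract [:[:[:[:0, 1:]:]:]:] 1
      else if n = 3 then Fraction_Field.Fract [:[:[:0, 1:]:]:] 1
      else if n = 4 then Fraction_Field.Fract [:[:0, 1:]:] 1
      else if n = 5 then Fraction_Field.Fract [:0, 1:] 1
      else 0)"

function x :: "int \<Rightarrow> ratfun" where
  "x n =
     (if n \<ge> 6 then (x (n - 1) * x (n - 4) + x (n - 2) * x (n - 3)) / x (n - 5)
      else if n \<le> 0 then (x (n + 1) * x (n + 4) + x (n + 2) * x (n + 3)) / x (n + 5)
      else indet n)"
  by pat_completeness auto
termination
  by (relation "measure (\<lambda>n. nat \<bar>n - 3\<bar>)") auto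

declare x.simps [simp del]

definition initial_seed :: "ratfun seed" where
  "initial_seed = (Q, \<lambda>i. indet (int i))"

definition A :: ratfun where
  "A = (x 1 * x 5 + (x 3)\<^sup>2) / (x 2 * x 4)"

definition B :: ratfun where
  "B = (x 2 * x 6 + (x 4)\<^sup>2) / (x 3 * x 5)"

text \<open>Division on \<open>int\<close> rounds down, so it is the floor of the quotient.\<close>

definition g :: "int \<Rightarrow> int \<Rightarrow> int" where
  "g s k = (if even k then (s div 2) * ((s + 1) div 2) else ((s - 1) div 2) * (s div 2))"

lemma is_quiver_Q: "is_quiver Q"
  by (auto simp: is_quiver_def Q_def vertices_def split: if_splits)

lemma is_quiver_mutate:
  assumes "is_quiver a" "i \<in> vertices"
  shows "is_quiver (mutate_quiver i a)"
proof -
  have supp: "a j k = 0" if "j \<notin> vertices \<or> k \<notin> vertices" for j k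
    using assms(1) that by (auto simp: is_quiver_def)
  show ?thesis
    unfolding is_quiver_def
  proof (intro conjI allI impI)
    fix j k
    assume *: "mutate_quiver i a j k > 0"
    show "j \<in> vertices"
      by (rule ccontr) (use * in \<open>simp add: mutate_quiver_def delete_2cycles_def
            reverse_at_def add_paths_def supp split: if_splits\<close>)
    show "k \<in> vertices"
      by (rule ccontr) (use * in \<open>simp add: mutate_quiver_def delete_2cycles_def
            reverse_at_def add_paths_def supp split: if_splits\<close>)
  qed (auto simp: mutate_quiver_def delete_2cycles_def)
qed

end

theory Submission
  imports Defs
begin

text \<open>All three operations fix the quiver, so only the cluster moves. On clusters \<open>\<rho>\<^sub>1\<close> and
  \<open>\<rho>\<^sub>2\<close> are the two directions of the Somos-5 recurrence. The quantity
  \<open>C\<^sub>n = (x\<^sub>n x\<^sub>n\<^sub>+\<^sub>4 + x\<^sub>n\<^sub>+\<^sub>2\<^sup>2) / (x\<^sub>n\<^sub>+\<^sub>1 x\<^sub>n\<^sub>+\<^sub>3)\<close> has period 2 in \<open>n\<close>, so it equals \<open>A\<close> or \<open>B\<close>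
  according to the parity of \<open>n\<close>. A cluster of the form
  \<open>(P x\<^sub>n, R x\<^sub>n\<^sub>+\<^sub>1, P x\<^sub>n\<^sub>+\<^sub>2, R x\<^sub>n\<^sub>+\<^sub>3, P x\<^sub>n\<^sub>+\<^sub>4)\<close> is sent by \<open>\<rho>\<^sub>3\<rho>\<^sub>1\<close> to one of the same form
  with \<open>(n, P, R)\<close> replaced by \<open>(n + 1, C\<^sub>n P\<^sup>2 / R, P)\<close>, and the exponents given by \<open>g\<close> solve
  this second-order recurrence. Every division is legitimate because all the rational functions
  involved are positive for the order on the fraction field induced by leading coefficients.\<close>

section \<open>The operations on seeds with quiver \<open>Q\<close>\<close>

lemma vertices_eq: "vertices = {1, 2, 3, 4, 5}"
  by (auto simp: vertices_def)

text \<open>Bijectivity turns each value of \<open>inv\<close> into a forward evaluation of the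
  cycle; support in \<open>vertices\<close> keeps a relabelled quiver supported there.\<close>

lemma cycles_permute_vertices:
  "cycle_of_list [5, 4, 3, 2, 1] permutes vertices"
  "cycle_of_list [1, 2, 3, 4, 5] permutes vertices"
  "cycle_of_list [2, 4] permutes vertices"
proof -
  have "cycle_of_list cs permutes vertices" if "set cs \<subseteq> vertices" for cs
    using permutes_subset[OF cycle_permutes that] .
  then show "cycle_of_list [5, 4, 3, 2, 1] permutes vertices"
    "cycle_of_list [1, 2, 3, 4, 5] permutes vertices"
    "cycle_of_list [2, 4] permutes vertices"
    by (simp_all add: vertices_def del: cycle_of_list.simps)
qed

lemma inv_cycle_54321:
  "inv (cycle_of_list [5, 4, 3, 2, 1]) 1 = (2 :: nat)"
  "inv (cycle_of_list [5, 4, 3, 2, 1]) 2 = (3 :: nat)"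
  "inv (cycle_of_list [5, 4, 3, 2, 1]) 3 = (4 :: nat)"
  "inv (cycle_of_list [5, 4, 3, 2, 1]) 4 = (5 :: nat)"
  "inv (cycle_of_list [5, 4, 3, 2, 1]) 5 = (1 :: nat)"
  unfolding permutes_inv_eq[OF cycles_permute_vertices(1)] by (simp_all add: transpose_def)

lemma inv_cycle_12345:
  "inv (cycle_of_list [1, 2, 3, 4, 5]) 1 = (5 :: nat)"
  "inv (cycle_of_list [1, 2, 3, 4, 5]) 2 = (1 :: nat)"
  "inv (cycle_of_list [1, 2, 3, 4, 5]) 3 = (2 :: nat)"
  "inv (cycle_of_list [1, 2, 3, 4, 5]) 4 = (3 :: nat)"
  "inv (cycle_of_list [1, 2, 3, 4, 5]) 5 = (4 :: nat)"
  unfolding permutes_inv_eq[OF cycles_permute_vertices(2)] by (simp_all add: transpose_def)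

lemma inv_cycle_24:
  "inv (cycle_of_list [2, 4]) 1 = (1 :: nat)"
  "inv (cycle_of_list [2, 4]) 2 = (4 :: nat)"
  "inv (cycle_of_list [2, 4]) 3 = (3 :: nat)"
  "inv (cycle_of_list [2, 4]) 4 = (2 :: nat)"
  "inv (cycle_of_list [2, 4]) 5 = (5 :: nat)"
  unfolding permutes_inv_eq[OF cycles_permute_vertices(3)] by (simp_all add: transpose_def)

lemma Q_values:
  "Q 1 1 = 0" "Q 1 2 = 1" "Q 1 3 = 0" "Q 1 4 = 0" "Q 1 5 = 1"
  "Q 2 1 = 0" "Q 2 2 = 0" "Q 2 3 = 2" "Q 2 4 = 0" "Q 2 5 = 0"
  "Q 3 1 = 1" "Q 3 2 = 0" "Q 3 3 = 0" "Q 3 4 = 2" "Q 3 5 = 0"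
  "Q 4 1 = 1" "Q 4 2 = 0" "Q 4 3 = 0" "Q 4 4 = 0" "Q 4 5 = 1"
  "Q 5 1 = 0" "Q 5 2 = 1" "Q 5 3 = 1" "Q 5 4 = 0" "Q 5 5 = 0"
  by (simp_all add: Q_def)

section \<open>Invariance of the quiver under the three operations\<close>

lemma mutate_quiver_apply:
  "mutate_quiver i a j k =
    (if j = i \<or> k = i then (a k j + a k i * a i j) - (a j k + a j i * a i k)
     else (a j k + a j i * a i k) - (a k j + a k i * a i j))"
  by (auto simp: mutate_quiver_def delete_2cycles_def reverse_at_def add_paths_def)

lemma is_quiver_outside:
  assumes "is_quiver a" "\<not> (i \<in> vertices \<and> j \<in> vertices)"
  shows "a i j = 0"
  using assms unfolding is_quiver_def by (metis gr0I)

lemma quiver_eqI: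
  assumes "is_quiver a" "is_quiver b" and "\<forall>i \<in> vertices. \<forall>j \<in> vertices. a i j = b i j"
  shows "a = b"
proof (intro ext)
  fix i j
  show "a i j = b i j"
  proof (cases "i \<in> vertices \<and> j \<in> vertices")
    case True
    then show ?thesis using assms(3) by blast
  next
    case False
    then show ?thesis using assms(1,2) by (metis is_quiver_outside)
  qed
qed

lemma is_quiver_relabel:
  assumes "is_quiver a" "\<sigma> permutes vertices"
  shows "is_quiver (fst (relabel \<sigma> (a, y)))"
  using assms(1) unfolding is_quiver_def relabel_def prod.case fst_conv
  by (metis permutes_in_image[OF permutes_inv[OF assms(2)]])

lemma fst_rho1_Q: "fst (rho1 (Q, y)) = Q"
proof (rule quiver_eqI)
  show "is_quiver (fst (rho1 (Q, y)))"
    unfolding rho1_def mutate_def comp_def prod.case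
    by (intro is_quiver_relabel is_quiver_mutate is_quiver_Q cycles_permute_vertices)
      (simp_all add: vertices_def)
  show "\<forall>i \<in> vertices. \<forall>j \<in> vertices. fst (rho1 (Q, y)) i j = Q i j"
    unfolding rho1_def mutate_def relabel_def comp_def prod.case fst_conv vertices_eq ball_simps
      inv_cycle_54321
    by (simp add: mutate_quiver_apply Q_values del: One_nat_def)
qed (rule is_quiver_Q)

lemma fst_rho2_Q: "fst (rho2 (Q, y)) = Q"
proof (rule quiver_eqI)
  show "is_quiver (fst (rho2 (Q, y)))"
    unfolding rho2_def mutate_def comp_def prod.case
    by (intro is_quiver_relabel is_quiver_mutate is_quiver_Q cycles_permute_vertices)
      (simp_all add: vertices_def)
  show "\<forall>i \<in> vertices. \<forall>j \<in> vertices. fst (rho2 (Q, y)) i j = Q i j"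
    unfolding rho2_def mutate_def relabel_def comp_def prod.case fst_conv vertices_eq ball_simps
      inv_cycle_12345
    by (simp add: mutate_quiver_apply Q_values del: One_nat_def)
qed (rule is_quiver_Q)

text \<open>Among 1, 3, 5 the arrows added through 4 cancel those added through 2, while 2 and 4
  exchange their roles; the swap undoes this.\<close>

lemma fst_rho3_Q: "fst (rho3 (Q, y)) = Q"
proof (rule quiver_eqI)
  show "is_quiver (fst (rho3 (Q, y)))"
    unfolding rho3_def mutate_def comp_def prod.case
    by (intro is_quiver_relabel is_quiver_mutate is_quiver_Q cycles_permute_vertices)
      (simp_all add: vertices_def)
  show "\<forall>i \<in> vertices. \<forall>j \<in> vertices. fst (rho3 (Q, y)) i j = Q i j"
    unfolding rho3_def mutate_def relabel_def comp_def prod.case fst_conv vertices_eq ball_simps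
      inv_cycle_24
    by (simp add: mutate_quiver_apply Q_values del: One_nat_def)
qed (rule is_quiver_Q)

lemma ordered_cluster_rho1_Q:
  "ordered_cluster (rho1 (Q, y)) = [y 2, y 3, y 4, y 5, (y 2 * y 5 + y 3 * y 4) / y 1]"
  unfolding rho1_def mutate_def relabel_def comp_def prod.case ordered_cluster_def snd_conv list.map
    inv_cycle_54321 vertices_eq
  by (simp add: Q_values del: One_nat_def)

lemma ordered_cluster_rho2_Q:
  "ordered_cluster (rho2 (Q, y)) = [(y 1 * y 4 + y 2 * y 3) / y 5, y 1, y 2, y 3, y 4]"
  unfolding rho2_def mutate_def relabel_def comp_def prod.case ordered_cluster_def snd_conv list.map
    inv_cycle_12345 vertices_eq
  by (simp add: Q_values del: One_nat_def)

text \<open>No arrow joins 2 and 4, so \<open>mutate 2\<close> only reverses arrows at 2 and changes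
  none at 4. Both exchanges thus have the same numerator, free of \<open>y 2\<close> and
  \<open>y 4\<close>.\<close>

lemma ordered_cluster_rho3_Q:
  "ordered_cluster (rho3 (Q, y)) =
    [y 1, (y 1 * y 5 + (y 3)\<^sup>2) / y 4, y 3, (y 1 * y 5 + (y 3)\<^sup>2) / y 2, y 5]"
  unfolding rho3_def mutate_def relabel_def comp_def prod.case ordered_cluster_def snd_conv list.map
    inv_cycle_24 vertices_eq
  by (simp add: Q_values mutate_quiver_apply add.commute power2_eq_square del: One_nat_def)

section \<open>The Somos-5 sequence\<close>

lemma fract_of_pos: "0 < c \<Longrightarrow> 0 < Fraction_Field.Fract c (1 :: 'a :: linordered_idom)"
  by (simp add: Fraction_Field.zero_less_Fract_iff)

lemma const_poly_pos: "0 < c \<Longrightarrow> 0 < [:c :: 'a :: linordered_idom:]"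
  by (simp add: less_poly_def pos_poly_pCons)

lemma poly_X_pos: "0 < [:0, 1 :: 'a :: linordered_idom:]"
  by (simp add: less_poly_def pos_poly_pCons)

lemma indet_pos: "1 \<le> n \<Longrightarrow> n \<le> 5 \<Longrightarrow> 0 < indet n"
  by (auto simp: indet_def const_poly_pos poly_X_pos intro!: fract_of_pos)

lemma x_eq_indet: "1 \<le> n \<Longrightarrow> n \<le> 5 \<Longrightarrow> x n = indet n"
  by (subst x.simps) simp

text \<open>Neither direction of the recurrence subtracts, so positivity spreads outward from the
  five indeterminates.\<close>

lemma x_pos: "0 < x n"
proof (induction n rule: x.induct)
  case (1 n)
  show ?case
    using 1 by (subst x.simps) (auto intro!: divide_pos_pos add_pos_pos mult_pos_pos indet_pos)
qed

lemma x_nonzero [simp]: "x n \<noteq> 0"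
  using x_pos[of n] by simp

text \<open>With denominators cleared, the upward rule for \<open>x (n + 5)\<close> and the downward
  rule for \<open>x n\<close> are the same identity.\<close>

lemma x_somos5: "x n * x (n + 5) = x (n + 1) * x (n + 4) + x (n + 2) * x (n + 3)"
proof (cases "n \<ge> 1")
  case True
  then show ?thesis
    by (subst (2) x.simps) (simp add: add.commute mult.commute)
next
  case False
  then show ?thesis
    by (subst (1) x.simps) simp
qed

section \<open>The 2-periodic quotient\<close>

definition somos_quot :: "int \<Rightarrow> ratfun" where
  "somos_quot n = (x n * x (n + 4) + (x (n + 2))\<^sup>2) / (x (n + 1) * x (n + 3))"

lemma somos_quot_add_2: "somos_quot (n + 2) = somos_quot n"
proof -
  have "x n * x (n + 5) = x (n + 1) * x (n + 4) + x (n + 2) * x (n + 3)"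
    and "x (n + 1) * x (n + 6) = x (n + 2) * x (n + 5) + x (n + 3) * x (n + 4)"
    using x_somos5[of n] x_somos5[of "n + 1"] by (simp_all add: add.assoc)
  \<comment> \<open>Writing \<open>xi\<close> for \<open>x (n + i)\<close>, both relations reduce
    either side to \<open>x3 * (x1 * x4^2 + x2 * x3 * x4 + x2^2 * x5)\<close>.\<close>
  then have "(x (n + 2) * x (n + 6) + (x (n + 4))\<^sup>2) * (x (n + 1) * x (n + 3))
      = (x n * x (n + 4) + (x (n + 2))\<^sup>2) * (x (n + 3) * x (n + 5))"
    by algebra
  then show ?thesis
    by (simp add: somos_quot_def add.assoc frac_eq_eq)
qed

lemma somos_quot_add_even: "somos_quot (n + 2 * m) = somos_quot n"
proof (induction m rule: int_induct[of _ 0])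
  case (step1 i)
  then show ?case
    using somos_quot_add_2[of "n + 2 * i"] by (simp add: algebra_simps)
next
  case (step2 i)
  then show ?case
    using somos_quot_add_2[of "n + 2 * (i - 1)"] by (simp add: algebra_simps)
qed simp

lemma somos_quot_eq: "somos_quot n = (if odd n then A else B)"
proof (cases "odd n")
  case True
  then obtain m where "n = 1 + 2 * m"
    by (auto elim!: oddE)
  then show ?thesis
    by (simp add: somos_quot_add_even) (simp add: somos_quot_def A_def)
next
  case False
  \<comment> \<open>The base point is 2 rather than 0 because \<open>B\<close> is the quotient at
    index 2.\<close>
  then obtain m where "n = 2 + 2 * (m - 1)"
    by (auto elim!: evenE)
  then show ?thesis
    using False by (simp only: somos_quot_add_even) (simp add: somos_quot_def B_def)
qed

lemma somos_quot_pos: "0 < somos_quot n"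
  unfolding somos_quot_def
  by (intro divide_pos_pos add_pos_pos mult_pos_pos zero_less_power x_pos)

lemma A_nonzero [simp]: "A \<noteq> 0" and B_nonzero [simp]: "B \<noteq> 0"
  using somos_quot_pos[of 1] somos_quot_pos[of 2] by (simp_all add: somos_quot_eq)

lemma x_numerator:
  "x n * x (n + 4) + (x (n + 2))\<^sup>2 = somos_quot n * x (n + 1) * x (n + 3)"
  by (simp add: somos_quot_def)

section \<open>Clusters\<close>

definition scaled_seed :: "ratfun \<Rightarrow> ratfun \<Rightarrow> int \<Rightarrow> ratfun seed \<Rightarrow> bool" where
  "scaled_seed P R n S \<longleftrightarrow> fst S = Q \<and>
     ordered_cluster S = [P * x n, R * x (n + 1), P * x (n + 2), R * x (n + 3), P * x (n + 4)]"

lemma scaled_seedE: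
  assumes "scaled_seed P R n S"
  obtains y where "S = (Q, y)"
    "y 1 = P * x n" "y 2 = R * x (n + 1)" "y 3 = P * x (n + 2)" "y 4 = R * x (n + 3)"
    "y 5 = P * x (n + 4)"
  using assms by (cases S) (simp add: scaled_seed_def ordered_cluster_def)

text \<open>Each monomial of the exchange pairs an odd with an even vertex, so \<open>P * R\<close>
  factors out and division by \<open>y 1\<close> leaves \<open>R\<close>. The rotation changes the
  parity of the positions, hence the swap of \<open>P\<close> and \<open>R\<close>.\<close>

lemma scaled_seed_rho1:
  assumes "scaled_seed P R n S" "P \<noteq> 0"
  shows "scaled_seed R P (n + 1) (rho1 S)"
proof -
  obtain y where S: "S = (Q, y)"
    and y: "y 1 = P * x n" "y 2 = R * x (n + 1)" "y 3 = P * x (n + 2)" "y 4 = R * x (n + 3)"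
      "y 5 = P * x (n + 4)"
    using assms(1) by (rule scaled_seedE)
  have "y 2 * y 5 + y 3 * y 4 = R * x (n + 5) * y 1"
    using x_somos5[of n] unfolding y by algebra
  moreover have "y 1 \<noteq> 0"
    using assms(2) unfolding y by simp
  ultimately have "(y 2 * y 5 + y 3 * y 4) / y 1 = R * x (n + 5)"
    by (simp only: nonzero_mult_div_cancel_right not_False_eq_True)
  then show ?thesis
    unfolding S scaled_seed_def ordered_cluster_rho1_Q y(2-) by (simp add: fst_rho1_Q add.assoc)
qed

lemma scaled_seed_rho2:
  assumes "scaled_seed P R (n + 1) S" "P \<noteq> 0"
  shows "scaled_seed R P n (rho2 S)"
proof -
  obtain y where S: "S = (Q, y)"
    and y: "y 1 = P * x (n + 1)" "y 2 = R * x (n + 1 + 1)" "y 3 = P * x (n + 1 + 2)"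
      "y 4 = R * x (n + 1 + 3)" "y 5 = P * x (n + 1 + 4)"
    using assms(1) by (rule scaled_seedE)
  have "y 1 * y 4 + y 2 * y 3 = R * x n * y 5"
    using x_somos5[of n] unfolding y by (simp add: add.assoc) algebra
  moreover have "y 5 \<noteq> 0"
    using assms(2) unfolding y by simp
  ultimately have "(y 1 * y 4 + y 2 * y 3) / y 5 = R * x n"
    by (simp only: nonzero_mult_div_cancel_right not_False_eq_True)
  then show ?thesis
    unfolding S scaled_seed_def ordered_cluster_rho2_Q y(1-4) by (simp add: fst_rho2_Q add.assoc)
qed

lemma scaled_seed_rho3:
  assumes "scaled_seed P R n S" "R \<noteq> 0"
  shows "scaled_seed P (somos_quot n * P\<^sup>2 / R) n (rho3 S)"
proof -
  obtain y where S: "S = (Q, y)"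
    and y: "y 1 = P * x n" "y 2 = R * x (n + 1)" "y 3 = P * x (n + 2)" "y 4 = R * x (n + 3)"
      "y 5 = P * x (n + 4)"
    using assms(1) by (rule scaled_seedE)
  have "y 1 * y 5 + (y 3)\<^sup>2 = somos_quot n * P\<^sup>2 * x (n + 1) * x (n + 3)"
    using x_numerator[of n] unfolding y by algebra
  \<comment> \<open>Dividing by \<open>y 4\<close> leaves \<open>x (n + 1)\<close>, and the swap
    (24) places it at vertex 2, so the indices stay in order.\<close>
  then have "(y 1 * y 5 + (y 3)\<^sup>2) / y 4 = somos_quot n * P\<^sup>2 / R * x (n + 1)"
    and "(y 1 * y 5 + (y 3)\<^sup>2) / y 2 = somos_quot n * P\<^sup>2 / R * x (n + 3)"
    using assms(2) by (simp_all add: y(2,4))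
  then show ?thesis
    unfolding S scaled_seed_def ordered_cluster_rho3_Q by (simp add: fst_rho3_Q y(1,3,5)[simplified])
qed

lemma scaled_seed_initial: "scaled_seed 1 1 1 initial_seed"
  by (simp add: scaled_seed_def initial_seed_def ordered_cluster_def x_eq_indet)

text \<open>Both factors are 1, so their swap at each step is invisible and only the index
  moves.\<close>

lemma scaled_seed_rho1_pow: "scaled_seed 1 1 (k + 1) (rho1_pow k initial_seed)"
proof (cases "k \<ge> 0")
  case True
  have "scaled_seed 1 1 (int m + 1) ((rho1 ^^ m) initial_seed)" for m
  proof (induction m)
    case (Suc m)
    then show ?case
      using scaled_seed_rho1[OF Suc] by (simp add: add.commute)
  qed (simp add: scaled_seed_initial)
  from this[of "nat k"] True show ?thesis
    by (simp add: rho1_pow_def)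
next
  case False
  have "scaled_seed 1 1 (1 - int m) ((rho2 ^^ m) initial_seed)" for m
  proof (induction m)
    case (Suc m)
    then show ?case
      using scaled_seed_rho2[of 1 1 "- int m"] by (simp add: add.commute)
  qed (simp add: scaled_seed_initial)
  from this[of "nat (- k)"] False show ?thesis
    by (simp add: rho1_pow_def add.commute)
qed

section \<open>Arithmetic of the exponents\<close>

text \<open>These are the quarter squares, the floor of \<open>s^2 / 4\<close> for even
  \<open>k\<close> and of \<open>(s - 1)^2 / 4\<close> for odd \<open>k\<close>; their second
  differences alternate between 1 and 0.\<close>

lemma g_second_difference:
  "g (s + 2) k = 2 * g (s + 1) k - g s k + (if even (k + s) then 1 else 0)"
proof (cases "even s")
  case True
  then obtain m where "s = 2 * m" by blast
  moreover have "(2 * m - 1) div 2 = m - 1" "(2 * m + 1) div 2 = m" "(2 * m + 2) div 2 = m + 1"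
    "(2 * m + 3) div 2 = m + 1"
    by simp_all
  ultimately show ?thesis
    by (simp add: g_def) (simp add: algebra_simps)
next
  case False
  then obtain m where "s = 2 * m + 1" by (blast elim: oddE)
  moreover have "(2 * m + 1) div 2 = m" "(2 * m + 2) div 2 = m + 1" "(2 * m + 3) div 2 = m + 1"
    "(2 * m + 4) div 2 = m + 2"
    by simp_all
  ultimately show ?thesis
    by (simp add: g_def) (simp add: algebra_simps)
qed

lemma power_int_second_difference:
  fixes c :: "'a :: field"
  assumes "c \<noteq> 0"
  shows "c powi (2 * m - n + d) = (c powi m)\<^sup>2 / c powi n * c powi d"
  unfolding mult_2 by (simp only: assms power_int_add power_int_diff power2_eq_square simp_thms)

definition scale :: "int \<Rightarrow> int \<Rightarrow> ratfun" where
  "scale s k = A powi g s k * B powi g s (k + 1)"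

lemma scale_nonzero: "scale s k \<noteq> 0"
  by (simp add: scale_def)

lemma scale_rec: "scale (s + 2) k = somos_quot (k + s + 1) * (scale (s + 1) k)\<^sup>2 / scale s k"
proof -
  \<comment> \<open>Exactly one of the two increments is 1, and its base is the value of
    \<open>somos_quot\<close> for the parity of \<open>k + s + 1\<close>.\<close>
  have "A powi (if even (k + s) then 1 else 0) * B powi (if even (k + 1 + s) then 1 else 0)
      = somos_quot (k + s + 1)"
    by (auto simp: somos_quot_eq)
  then show ?thesis
    unfolding scale_def g_second_difference power_int_second_difference[OF A_nonzero]
      power_int_second_difference[OF B_nonzero]
    by (simp only: power_mult_distrib times_divide_eq_left times_divide_eq_right
        divide_divide_eq_left mult_ac flip: \<open>_ = somos_quot _\<close>)
qed

lemma scaled_seed_iterate: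
  "scaled_seed (scale (int s + 1) k) (scale (int s) k) (k + int s + 1)
     (((rho1 \<circ> rho3) ^^ s) (rho1_pow k initial_seed))"
proof (induction s)
  \<comment> \<open>\<open>g\<close> vanishes at 0 and 1 for either parity of \<open>k\<close>, so
    both scale factors start at 1.\<close>
  case 0
  then show ?case
    using scaled_seed_rho1_pow[of k] by (simp add: scale_def g_def)
next
  case (Suc s)
  \<comment> \<open>\<open>rho3\<close> replaces the factor with argument \<open>s\<close> by this
    one; \<open>rho1\<close> then swaps the two factors and advances the index.\<close>
  let ?P = "scale (int s + 2) k"
  have "scaled_seed (scale (int s + 1) k) ?P (k + int s + 1)
      (rho3 (((rho1 \<circ> rho3) ^^ s) (rho1_pow k initial_seed)))"
    using scaled_seed_rho3[OF Suc scale_nonzero] unfolding scale_rec .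
  from scaled_seed_rho1[OF this scale_nonzero] show ?case
    unfolding funpow.simps(2) o_apply of_nat_Suc by (simp add: algebra_simps del: o_apply)
qed

theorem theorem4p4:
  fixes k :: int and s :: nat
  shows "ordered_cluster (((rho1 \<circ> rho3) ^^ s) (rho1_pow k initial_seed)) =
    [A powi g (int s + 1) k * B powi g (int s + 1) (k + 1) * x (k + int s + 1),
     A powi g (int s) k * B powi g (int s) (k + 1) * x (k + int s + 2),
     A powi g (int s + 1) k * B powi g (int s + 1) (k + 1) * x (k + int s + 3),
     A powi g (int s) k * B powi g (int s) (k + 1) * x (k + int s + 4),
     A powi g (int s + 1) k * B powi g (int s + 1) (k + 1) * x (k + int s + 5)]"
  using scaled_seed_iterate[of s k] by (simp add: scaled_seed_def scale_def add.assoc)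

end
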